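(* Let $G$ be a finitely generated group, let $H$ be a subgroup of $G$ of finite index, and let $A$ be a finite set with at least two elements. Then \[ \psi_H(G;A) = \sum_{H \leq K \leq G} \mu(H,K)\, |A|^{[G:K]}, \] where the sum is over all subgroups $K$ of $G$ containing $H$, and $\mu$ is the Möbius function of the poset $L(G)$ of all finite index subgroups of $G$ ordered by inclusion.
   Context: For a group $G$ and a set $A$, $A^G$ is the set of all functions $G\to A$ (called configurations), with the shift action $(g\cdot x)(h) := x(g^{-1}h)$ for $g,h\in G$, $x\in A^G$. The stabiliser of $x\in A^G$ is $G_x := \{g\in G : g\cdot x = x\}$. For a subgroup $H\leq G$, $\psi_H(G;A) := |\{x\in A^G : G_x = H\}|$ (the number of configurations with least period $H$). $L(G)$ denotes the poset of all subgroups of $G$ of finite index, ordered by inclusion; when $G$ is finitely generated it is locally finite (every closed interval is finite). The Möbius function of a locally finite poset $P$ is the map $\mu : P\times P\to\mathbb{Z}$ determined by $\mu(a,a)=1$ for all $a\in P$; $\mu(a,b)=0$ whenever $a\not\leq b$; and $\sum_{a\leq c\leq b}\mu(a,c)=0$ for all $a<b$. *)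

theory Defs
  imports "HOL-Algebra.Algebra"
begin

definition finitely_generated :: "('g, 'm) monoid_scheme \<Rightarrow> bool" where
  "finitely_generated G \<longleftrightarrow>
     (\<exists>S. finite S \<and> S \<subseteq> carrier G \<and> generate G S = carrier G)"

text \<open>The index is only meaningful when \<open>finite (rcosets\<^bsub>G\<^esub> H)\<close>; otherwise it is \<open>0\<close>.\<close>

definition subgroup_index :: "('g, 'm) monoid_scheme \<Rightarrow> 'g set \<Rightarrow> nat" where
  "subgroup_index G H = card (rcosets\<^bsub>G\<^esub> H)"

definition finite_index_subgroups :: "('g, 'm) monoid_scheme \<Rightarrow> 'g set set" where
  "finite_index_subgroups G = {H. subgroup H G \<and> finite (rcosets\<^bsub>G\<^esub> H)}"


text \<open>Maps from \<open>carrier G\<close> to \<open>A\<close> are represented by extensional functions,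
  so that equality of configurations is equality of HOL functions.\<close>

definition configurations :: "('g, 'm) monoid_scheme \<Rightarrow> 'a set \<Rightarrow> ('g \<Rightarrow> 'a) set" where
  "configurations G A = carrier G \<rightarrow>\<^sub>E A"

definition shift :: "('g, 'm) monoid_scheme \<Rightarrow> 'g \<Rightarrow> ('g \<Rightarrow> 'a) \<Rightarrow> ('g \<Rightarrow> 'a)" where
  "shift G g x = (\<lambda>h\<in>carrier G. x (inv\<^bsub>G\<^esub> g \<otimes>\<^bsub>G\<^esub> h))"

definition psi :: "('g, 'm) monoid_scheme \<Rightarrow> 'a set \<Rightarrow> 'g set \<Rightarrow> nat" where
  "psi G A H = card {x \<in> configurations G A. stabilizer G (shift G) x = H}"


text \<open>A poset is given by a subset \<open>P\<close> of an ordered type, with the induced order. A map on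
  \<open>P \<times> P\<close> is represented by a binary function that vanishes outside \<open>P \<times> P\<close>; this convention
  makes the Moebius function unique as a HOL function.\<close>

definition is_moebius_function :: "'p::order set \<Rightarrow> ('p \<Rightarrow> 'p \<Rightarrow> int) \<Rightarrow> bool" where
  "is_moebius_function P \<mu> \<longleftrightarrow>
     (\<forall>a\<in>P. \<mu> a a = 1) \<and>
     (\<forall>a\<in>P. \<forall>b\<in>P. \<not> a \<le> b \<longrightarrow> \<mu> a b = 0) \<and>
     (\<forall>a\<in>P. \<forall>b\<in>P. a < b \<longrightarrow> (\<Sum>c | c \<in> P \<and> a \<le> c \<and> c \<le> b. \<mu> a c) = 0) \<and>
     (\<forall>a b. a \<notin> P \<or> b \<notin> P \<longrightarrow> \<mu> a b = 0)"

definition moebius :: "'p::order set \<Rightarrow> 'p \<Rightarrow> 'p \<Rightarrow> int" where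
  "moebius P = (THE \<mu>. is_moebius_function P \<mu>)"

text \<open>On a locally finite poset the definite description above is well defined. The following
  recursion provides the witness.\<close>

function moebius_rec :: "'p::order set \<Rightarrow> 'p \<Rightarrow> 'p \<Rightarrow> int" where
  "moebius_rec P a b =
     (if a \<in> P \<and> b \<in> P \<and> finite {c \<in> P. a \<le> c \<and> c \<le> b} then
        if a = b then 1
        else if a < b then - (\<Sum>c | c \<in> P \<and> a \<le> c \<and> c < b. moebius_rec P a c)
        else 0
      else 0)"
  by pat_completeness auto
termination
proof (relation "measure (\<lambda>(P, a, b). card {c \<in> P. a \<le> c \<and> c \<le> b})", goal_cases)
  case 1
  show ?case by simp
next
  case (2 P a b c)
  have "{d \<in> P. a \<le> d \<and> d \<le> c} \<subset> {d \<in> P. a \<le> d \<and> d \<le> b}"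
    using 2 by (auto dest: order_le_less_trans)
  moreover have "finite {d \<in> P. a \<le> d \<and> d \<le> b}"
    using 2 by blast
  ultimately show ?case
    by (simp add: psubset_card_mono)
qed

declare moebius_rec.simps [simp del]

lemma closed_interval_eq_insert:
  fixes P :: "'p::order set"
  assumes "b \<in> P" "a < b"
  shows "{c \<in> P. a \<le> c \<and> c \<le> b} = insert b {c \<in> P. a \<le> c \<and> c < b}"
  using assms by (auto simp: le_less)

lemma is_moebius_function_moebius_rec:
  fixes P :: "'p::order set"
  assumes fin: "\<And>a b. a \<in> P \<Longrightarrow> b \<in> P \<Longrightarrow> finite {c \<in> P. a \<le> c \<and> c \<le> b}"
  shows "is_moebius_function P (moebius_rec P)"
proof -
  have "(\<Sum>c | c \<in> P \<and> a \<le> c \<and> c \<le> b. moebius_rec P a c) = 0"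
    if ab: "a \<in> P" "b \<in> P" "a < b" for a b
  proof -
    have "finite {c \<in> P. a \<le> c \<and> c < b}"
      by (rule finite_subset[OF _ fin[OF ab(1,2)]]) auto
    from sum.insert[OF this, of b "moebius_rec P a"]
    have "(\<Sum>c | c \<in> P \<and> a \<le> c \<and> c \<le> b. moebius_rec P a c)
        = moebius_rec P a b + (\<Sum>c | c \<in> P \<and> a \<le> c \<and> c < b. moebius_rec P a c)"
      unfolding closed_interval_eq_insert[OF ab(2,3)] by simp
    moreover have "moebius_rec P a b = - (\<Sum>c | c \<in> P \<and> a \<le> c \<and> c < b. moebius_rec P a c)"
      using ab fin[OF ab(1,2)]
      by (subst moebius_rec.simps) (simp only: if_True if_False simp_thms less_imp_neq)
    ultimately show ?thesis
      by simp
  qed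
  moreover have "moebius_rec P a a = 1" if "a \<in> P" for a
    using that fin[OF that that] by (subst moebius_rec.simps) (simp only: if_True simp_thms)
  moreover have "moebius_rec P a b = 0" if "\<not> a \<le> b" for a b
  proof -
    have "a \<noteq> b" "\<not> a < b"
      using that by auto
    then show ?thesis
      by (subst moebius_rec.simps) (simp only: if_False if_cancel)
  qed
  moreover have "moebius_rec P a b = 0" if "a \<notin> P \<or> b \<notin> P" for a b
    using that by (subst moebius_rec.simps) (elim disjE; simp only: if_False simp_thms)
  ultimately show ?thesis
    unfolding is_moebius_function_def by blast
qed

lemma is_moebius_function_unique:
  fixes P :: "'p::order set"
  assumes fin: "\<And>a b. a \<in> P \<Longrightarrow> b \<in> P \<Longrightarrow> finite {c \<in> P. a \<le> c \<and> c \<le> b}"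
    and \<mu>: "is_moebius_function P \<mu>" and \<nu>: "is_moebius_function P \<nu>"
  shows "\<mu> = \<nu>"
proof (intro ext)
  fix a b
  show "\<mu> a b = \<nu> a b"
  proof (induction "card {c \<in> P. a \<le> c \<and> c \<le> b}" arbitrary: b rule: less_induct)
    case less
    consider "a \<notin> P \<or> b \<notin> P \<or> \<not> a \<le> b \<or> a = b" | "a \<in> P" "b \<in> P" "a < b"
      by (auto simp: le_less)
    then show ?case
    proof cases
      case 1
      then show ?thesis
        using \<mu> \<nu> unfolding is_moebius_function_def by metis
    next
      case 2
      have IH: "\<mu> a c = \<nu> a c" if c: "c \<in> {c \<in> P. a \<le> c \<and> c < b}" for c
      proof (rule less)
        have "{d \<in> P. a \<le> d \<and> d \<le> c} \<subset> {d \<in> P. a \<le> d \<and> d \<le> b}"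
          using c 2 by (auto dest: order_le_less_trans)
        then show "card {d \<in> P. a \<le> d \<and> d \<le> c} < card {d \<in> P. a \<le> d \<and> d \<le> b}"
          using fin[OF 2(1,2)] by (rule psubset_card_mono[rotated])
      qed
      have fin': "finite {c \<in> P. a \<le> c \<and> c < b}"
        by (rule finite_subset[OF _ fin[OF 2(1,2)]]) auto
      have split: "\<kappa> a b + (\<Sum>c | c \<in> P \<and> a \<le> c \<and> c < b. \<kappa> a c) = 0"
        if "is_moebius_function P \<kappa>" for \<kappa>
      proof -
        have "(\<Sum>c\<in>{c \<in> P. a \<le> c \<and> c \<le> b}. \<kappa> a c) = 0"
          using that 2 unfolding is_moebius_function_def by blast
        then show ?thesis
          using fin' unfolding closed_interval_eq_insert[OF 2(2,3)] by (subst (asm) sum.insert) auto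
      qed
      have "(\<Sum>c | c \<in> P \<and> a \<le> c \<and> c < b. \<mu> a c) = (\<Sum>c | c \<in> P \<and> a \<le> c \<and> c < b. \<nu> a c)"
        by (rule sum.cong[OF refl IH])
      then show ?thesis
        using split[OF \<mu>] split[OF \<nu>] by linarith
    qed
  qed
qed

lemma is_moebius_function_moebius:
  fixes P :: "'p::order set"
  assumes "\<And>a b. a \<in> P \<Longrightarrow> b \<in> P \<Longrightarrow> finite {c \<in> P. a \<le> c \<and> c \<le> b}"
  shows "is_moebius_function P (moebius P)"
proof -
  have "is_moebius_function P (THE \<mu>. is_moebius_function P \<mu>)"
  proof (rule theI[where P = "is_moebius_function P" and a = "moebius_rec P"])
    show "is_moebius_function P (moebius_rec P)"
      by (rule is_moebius_function_moebius_rec) (rule assms)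
    fix \<mu>
    assume "is_moebius_function P \<mu>"
    then show "\<mu> = moebius_rec P"
      using is_moebius_function_moebius_rec[OF assms] is_moebius_function_unique[OF assms] by blast
  qed
  then show ?thesis
    by (simp only: moebius_def)
qed

end

theory Submission
  imports Defs
begin

text \<open>
  A configuration is fixed by all of a subgroup \<open>K\<close> exactly when it is constant on the right
  cosets of \<open>K\<close>, so a finite-index \<open>K\<close> fixes exactly \<open>|A|^[G:K]\<close> configurations. Sorting these
  configurations by their stabilisers, which are the subgroups \<open>L\<close> containing \<open>K\<close>, gives
  \<open>|A|^[G:K] = (\<Sum>L \<supseteq> K. \<psi>\<^sub>L)\<close>, and Moebius inversion over the subgroups above \<open>H\<close> solves this
  system for \<open>\<psi>\<^sub>H\<close>.

  Inversion requires that only finitely many subgroups lie above \<open>H\<close>. This follows from \<open>[G:H] < \<infinity>\<close>, since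
  each such subgroup is a union of right cosets of \<open>H\<close>. The same observation makes the poset of
  finite-index subgroups locally finite, so that its Moebius function satisfies the defining
  equations.
\<close>

section \<open>Moebius inversion\<close>

text \<open>The double sum \<open>\<Sum>a \<le> c \<le> d. \<mu> a c * g d\<close> collapses to its term at \<open>d = a\<close>, because the
  inner sum over \<open>c\<close> vanishes for every \<open>d > a\<close>.\<close>

lemma moebius_inversion_above:
  fixes P :: "'p::order set" and f g :: "'p \<Rightarrow> int"
  assumes \<mu>: "is_moebius_function P \<mu>"
    and a: "a \<in> P"
    and fin: "finite {c \<in> P. a \<le> c}"
    and f: "\<And>c. c \<in> P \<Longrightarrow> a \<le> c \<Longrightarrow> f c = (\<Sum>d | d \<in> P \<and> c \<le> d. g d)"
  shows "g a = (\<Sum>c | c \<in> P \<and> a \<le> c. \<mu> a c * f c)"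
proof -
  let ?U = "{c \<in> P. a \<le> c}"
  have "(\<Sum>c\<in>?U. \<mu> a c * f c) = (\<Sum>c\<in>?U. \<Sum>d | d \<in> ?U \<and> c \<le> d. \<mu> a c * g d)"
  proof (rule sum.cong[OF refl])
    fix c assume c: "c \<in> ?U"
    then have "{d. d \<in> P \<and> c \<le> d} = {d. d \<in> ?U \<and> c \<le> d}"
      by (auto intro: order_trans)
    with f[of c] c show "\<mu> a c * f c = (\<Sum>d | d \<in> ?U \<and> c \<le> d. \<mu> a c * g d)"
      by (simp add: sum_distrib_left)
  qed
  also have "\<dots> = (\<Sum>d\<in>?U. \<Sum>c | c \<in> ?U \<and> c \<le> d. \<mu> a c * g d)"
    by (rule sum.swap_restrict[OF fin fin])
  also have "\<dots> = (\<Sum>d\<in>?U. if d = a then g d else 0)"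
  proof (rule sum.cong[OF refl])
    fix d assume d: "d \<in> ?U"
    have "(\<Sum>c | c \<in> ?U \<and> c \<le> d. \<mu> a c) = (if d = a then 1 else 0)"
    proof (cases "d = a")
      case True
      then have "{c. c \<in> ?U \<and> c \<le> d} = {a}"
        using a by auto
      then show ?thesis
        using True \<mu> a by (simp add: is_moebius_function_def)
    next
      case False
      then have "a < d" using d by auto
      then have "(\<Sum>c | c \<in> P \<and> a \<le> c \<and> c \<le> d. \<mu> a c) = 0"
        using \<mu> a d by (simp add: is_moebius_function_def)
      then show ?thesis
        using False by (simp add: conj_assoc)
    qed
    then show "(\<Sum>c | c \<in> ?U \<and> c \<le> d. \<mu> a c * g d) = (if d = a then g d else 0)"
      by (simp flip: sum_distrib_right)
  qed
  also have "\<dots> = g a"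
    using a fin by (simp add: sum.delta)
  finally show ?thesis by simp
qed

section \<open>Subgroups above a finite-index subgroup\<close>

context group
begin

text \<open>With finitely many cosets of \<open>H\<close> there are only finitely many unions of them. Hence this
  decomposition bounds both the number of overgroups \<open>K\<close> and the index of each.\<close>

lemma r_coset_of_overgroup:
  assumes "subgroup H G" "subgroup K G" "H \<subseteq> K" "a \<in> carrier G"
  shows "K #> a = (\<Union>k\<in>K. H #> (k \<otimes> a))"
proof (intro equalityI subsetI)
  fix y assume "y \<in> K #> a"
  then obtain k where k: "k \<in> K" "y = k \<otimes> a"
    by (auto simp: r_coset_def)
  then have "y \<in> H #> (k \<otimes> a)"
    using assms by (auto intro: rcos_self dest: subgroup.mem_carrier)
  with k show "y \<in> (\<Union>k\<in>K. H #> (k \<otimes> a))" by blast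
next
  fix y assume "y \<in> (\<Union>k\<in>K. H #> (k \<otimes> a))"
  then obtain k h where "k \<in> K" "h \<in> H" "y = h \<otimes> (k \<otimes> a)"
    by (auto simp: r_coset_def)
  moreover from this have "h \<otimes> k \<in> K"
    using assms by (auto intro: subgroup.m_closed)
  moreover from calculation have "y = (h \<otimes> k) \<otimes> a"
    using assms by (simp add: m_assoc subgroup.mem_carrier)
  ultimately show "y \<in> K #> a"
    unfolding r_coset_def by blast
qed

lemma overgroup_eq_Union_rcosets:
  assumes "subgroup H G" "subgroup K G" "H \<subseteq> K"
  shows "K = \<Union> ((\<lambda>k. H #> k) ` K)"
proof -
  have "K #> \<one> = (\<Union>k\<in>K. H #> (k \<otimes> \<one>))"
    using assms by (intro r_coset_of_overgroup) auto
  moreover have "(\<Union>k\<in>K. H #> (k \<otimes> \<one>)) = (\<Union>k\<in>K. H #> k)"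
    using assms by (simp add: subgroup.mem_carrier cong: SUP_cong_simp)
  ultimately show ?thesis
    using assms by (simp add: subgroup.subset)
qed

lemma finite_overgroups:
  assumes "subgroup H G" "finite (rcosets H)"
  shows "finite {K. subgroup K G \<and> H \<subseteq> K}"
proof (rule finite_subset)
  show "{K. subgroup K G \<and> H \<subseteq> K} \<subseteq> Union ` Pow (rcosets H)"
  proof
    fix K assume "K \<in> {K. subgroup K G \<and> H \<subseteq> K}"
    then have K: "subgroup K G" "H \<subseteq> K" by auto
    have "(\<lambda>k. H #> k) ` K \<in> Pow (rcosets H)"
      using K by (auto simp: RCOSETS_def dest: subgroup.mem_carrier)
    then show "K \<in> Union ` Pow (rcosets H)"
      using overgroup_eq_Union_rcosets[OF assms(1) K] by blast
  qed
  show "finite (Union ` Pow (rcosets H))"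
    using assms(2) by simp
qed

lemma finite_rcosets_overgroup:
  assumes "subgroup H G" "finite (rcosets H)" "subgroup K G" "H \<subseteq> K"
  shows "finite (rcosets K)"
proof (rule finite_subset)
  show "rcosets K \<subseteq> Union ` Pow (rcosets H)"
  proof
    fix C assume "C \<in> rcosets K"
    then obtain a where a: "a \<in> carrier G" "C = K #> a"
      by (auto simp: RCOSETS_def)
    have "(\<lambda>k. H #> (k \<otimes> a)) ` K \<in> Pow (rcosets H)"
      using subgroup.mem_carrier[OF assms(3)] a by (auto intro!: rcosetsI subgroup.subset[OF assms(1)])
    then show "C \<in> Union ` Pow (rcosets H)"
      using r_coset_of_overgroup[OF assms(1,3,4) a(1)] a(2) by blast
  qed
  show "finite (Union ` Pow (rcosets H))"
    using assms(2) by simp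
qed

lemma finite_index_subgroups_above:
  assumes "H \<in> finite_index_subgroups G"
  shows "{K \<in> finite_index_subgroups G. H \<subseteq> K} = {K. subgroup K G \<and> H \<subseteq> K}"
  using assms finite_rcosets_overgroup by (auto simp: finite_index_subgroups_def)

lemma is_moebius_function_finite_index_subgroups:
  "is_moebius_function (finite_index_subgroups G) (moebius (finite_index_subgroups G))"
proof (rule is_moebius_function_moebius)
  fix H K assume "H \<in> finite_index_subgroups G"
  then have "finite {L. subgroup L G \<and> H \<subseteq> L}"
    using finite_overgroups by (simp add: finite_index_subgroups_def)
  then show "finite {L \<in> finite_index_subgroups G. H \<subseteq> L \<and> L \<subseteq> K}"
    by (rule finite_subset[rotated]) (auto simp: finite_index_subgroups_def)
qed

section \<open>Configurations fixed by a subgroup\<close>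

text \<open>The inverse in the definition of the shift disappears here because a subgroup is closed
  under inverses.\<close>

lemma subgroup_stabilises_iff:
  assumes "x \<in> configurations G A" "subgroup K G"
  shows "K \<subseteq> stabilizer G (shift G) x \<longleftrightarrow> (\<forall>k\<in>K. \<forall>h\<in>carrier G. x (k \<otimes> h) = x h)"
proof
  assume l: "K \<subseteq> stabilizer G (shift G) x"
  show "\<forall>k\<in>K. \<forall>h\<in>carrier G. x (k \<otimes> h) = x h"
  proof (intro ballI)
    fix k h assume k: "k \<in> K" and h: "h \<in> carrier G"
    have "inv k \<in> K"
      using assms(2) k by (rule subgroup.m_inv_closed)
    then have "shift G (inv k) x h = x h"
      using l by (auto simp: stabilizer_def)
    then show "x (k \<otimes> h) = x h"
      using h k assms(2) by (simp add: shift_def subgroup.mem_carrier)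
  qed
next
  assume r: "\<forall>k\<in>K. \<forall>h\<in>carrier G. x (k \<otimes> h) = x h"
  show "K \<subseteq> stabilizer G (shift G) x"
  proof
    fix k assume k: "k \<in> K"
    have "inv k \<in> K"
      using assms(2) k by (rule subgroup.m_inv_closed)
    then have "shift G k x = (\<lambda>h\<in>carrier G. x h)"
      using r by (auto simp: shift_def)
    also have "\<dots> = x"
      using assms(1) by (simp add: configurations_def PiE_restrict)
    finally show "k \<in> stabilizer G (shift G) x"
      using k assms(2) by (simp add: stabilizer_def subgroup.mem_carrier)
  qed
qed

lemma subgroup_stabilizer_shift:
  assumes "x \<in> configurations G A"
  shows "subgroup (stabilizer G (shift G) x) G"
proof -
  have one: "shift G \<one> x = x"
    using assms unfolding shift_def configurations_def
    by (metis (no_types, lifting) PiE_restrict inv_one l_one restrict_ext)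
  have mult: "shift G (g \<otimes> h) x = shift G g (shift G h x)"
    if "g \<in> carrier G" "h \<in> carrier G" for g h
    using that by (auto simp: shift_def inv_mult_group m_assoc)
  show ?thesis
  proof (rule subgroupI)
    show "stabilizer G (shift G) x \<noteq> {}"
      using one by (auto simp: stabilizer_def)
  next
    fix g assume g: "g \<in> stabilizer G (shift G) x"
    then have "shift G (inv g) x = shift G (inv g) (shift G g x)"
      by (simp add: stabilizer_def)
    also have "\<dots> = x"
      using g one mult[of "inv g" g] by (simp add: stabilizer_def)
    finally show "inv g \<in> stabilizer G (shift G) x"
      using g by (simp add: stabilizer_def)
  qed (auto simp: stabilizer_def mult)
qed

text \<open>A configuration fixed by \<open>K\<close> is the pullback, along \<open>h \<mapsto> K h\<close>, of a unique function on the
  right cosets of \<open>K\<close>.\<close>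

lemma bij_betw_fixed_configurations:
  assumes K: "subgroup K G"
  shows "bij_betw (\<lambda>f. \<lambda>h\<in>carrier G. f (K #> h)) (rcosets K \<rightarrow>\<^sub>E A)
    {x \<in> configurations G A. K \<subseteq> stabilizer G (shift G) x}"
    (is "bij_betw ?pull ?F ?X")
proof (rule bij_betw_imageI)
  show "inj_on ?pull ?F"
  proof (rule inj_onI)
    fix f f' assume f: "f \<in> ?F" "f' \<in> ?F" and eq: "?pull f = ?pull f'"
    show "f = f'"
    proof (rule PiE_ext[OF f])
      fix C assume "C \<in> rcosets K"
      then obtain h where "h \<in> carrier G" "C = K #> h"
        by (auto simp: RCOSETS_def)
      then show "f C = f' C"
        using fun_cong[OF eq, of h] by simp
    qed
  qed
  show "?pull ` ?F = ?X"
  proof (intro equalityI subsetI)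
    fix x assume "x \<in> ?pull ` ?F"
    then obtain f where f: "f \<in> ?F" and x: "x = ?pull f" by blast
    have conf: "x \<in> configurations G A"
      using f x by (auto simp: configurations_def RCOSETS_def)
    moreover have "x (k \<otimes> h) = x h" if "k \<in> K" "h \<in> carrier G" for k h
    proof -
      have kc: "k \<in> carrier G"
        using K that by (simp add: subgroup.mem_carrier)
      then have "K #> (k \<otimes> h) = (K #> k) #> h"
        using K that by (simp add: coset_mult_assoc subgroup.subset)
      also have "\<dots> = K #> h"
        using K that kc by (simp add: coset_join2)
      finally show ?thesis
        using that kc x by simp
    qed
    ultimately show "x \<in> ?X"
      using subgroup_stabilises_iff[OF conf K] by blast
  next
    fix x assume "x \<in> ?X"
    then have conf: "x \<in> configurations G A"
      and inv: "\<And>k h. k \<in> K \<Longrightarrow> h \<in> carrier G \<Longrightarrow> x (k \<otimes> h) = x h"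
      using subgroup_stabilises_iff[OF _ K, of x A] by auto
    define f where "f = (\<lambda>C\<in>rcosets K. x (SOME c. c \<in> C))"
    have f_coset: "f (K #> h) = x h" if h: "h \<in> carrier G" for h
    proof -
      have "(SOME c. c \<in> K #> h) \<in> K #> h"
        using rcos_self[OF h K] by (rule someI)
      then obtain k where "k \<in> K" "(SOME c. c \<in> K #> h) = k \<otimes> h"
        by (auto simp: r_coset_def)
      then show ?thesis
        using inv h by (auto simp: f_def RCOSETS_def)
    qed
    have "f \<in> ?F"
    proof (rule PiE_I)
      fix C assume "C \<in> rcosets K"
      then show "f C \<in> A"
        using conf f_coset by (auto simp: RCOSETS_def configurations_def)
    qed (simp add: f_def)
    moreover have "x = ?pull f"
    proof (rule ext)
      fix h show "x h = ?pull f h"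
        using conf f_coset by (auto simp: configurations_def)
    qed
    ultimately show "x \<in> ?pull ` ?F" by blast
  qed
qed

text \<open>The stabiliser of a configuration fixed by \<open>K\<close> is one of the finitely many overgroups \<open>L\<close> of
  \<open>K\<close>, so the fixed configurations split into finitely many
  disjoint classes.\<close>

lemma card_power_index_eq_sum_psi:
  assumes K: "subgroup K G" "finite (rcosets K)" and A: "finite A"
  shows "card A ^ subgroup_index G K = (\<Sum>L | subgroup L G \<and> K \<subseteq> L. psi G A L)"
proof -
  let ?X = "{x \<in> configurations G A. K \<subseteq> stabilizer G (shift G) x}"
  let ?Y = "\<lambda>L. {x \<in> configurations G A. stabilizer G (shift G) x = L}"
  note bij = bij_betw_fixed_configurations[OF K(1), of A]
  have "finite (rcosets K \<rightarrow>\<^sub>E A)"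
    using K(2) A by (rule finite_PiE)
  then have "finite ?X"
    using bij_betw_finite[OF bij] by simp
  have "card A ^ subgroup_index G K = card (rcosets K \<rightarrow>\<^sub>E A)"
    using K(2) by (simp add: card_PiE subgroup_index_def)
  also have "\<dots> = card ?X"
    by (rule bij_betw_same_card[OF bij])
  also have "?X = (\<Union>L\<in>{L. subgroup L G \<and> K \<subseteq> L}. ?Y L)"
    using subgroup_stabilizer_shift by auto
  also have "card \<dots> = (\<Sum>L | subgroup L G \<and> K \<subseteq> L. card (?Y L))"
  proof (rule card_UN_disjoint)
    show "finite {L. subgroup L G \<and> K \<subseteq> L}"
      using K by (rule finite_overgroups)
    show "\<forall>L\<in>{L. subgroup L G \<and> K \<subseteq> L}. finite (?Y L)"
      using \<open>finite ?X\<close> by (auto intro: finite_subset[rotated])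
  qed auto
  finally show ?thesis
    by (simp add: psi_def)
qed

end

section \<open>Configurations with a prescribed stabiliser\<close>

theorem theorem2:
  fixes G :: "('g, 'm) monoid_scheme" and H :: "'g set" and A :: "'a set"
  assumes "group G"
    and "finitely_generated G"
    and "subgroup H G"
    and "finite (rcosets\<^bsub>G\<^esub> H)"
    and "finite A"
    and "card A \<ge> 2"
  shows "int (psi G A H) =
    (\<Sum>K | subgroup K G \<and> H \<subseteq> K.
       moebius (finite_index_subgroups G) H K * int (card A) ^ subgroup_index G K)"
proof -
  interpret group G by fact
  let ?P = "finite_index_subgroups G"
  have H: "H \<in> ?P"
    using assms by (simp add: finite_index_subgroups_def)
  have "int (psi G A H) =
      (\<Sum>K | K \<in> ?P \<and> H \<subseteq> K. moebius ?P H K * int (card A) ^ subgroup_index G K)"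
  proof (rule moebius_inversion_above[OF is_moebius_function_finite_index_subgroups H])
    show "finite {K \<in> ?P. H \<subseteq> K}"
      using finite_overgroups assms(3,4) by (simp add: finite_index_subgroups_above[OF H])
  next
    fix K assume K: "K \<in> ?P"
    then have "card A ^ subgroup_index G K = (\<Sum>L | L \<in> ?P \<and> K \<subseteq> L. psi G A L)"
      using card_power_index_eq_sum_psi[OF _ _ assms(5)]
      by (simp add: finite_index_subgroups_above) (simp add: finite_index_subgroups_def)
    then show "int (card A) ^ subgroup_index G K = (\<Sum>L | L \<in> ?P \<and> K \<subseteq> L. int (psi G A L))"
      by (simp flip: of_nat_power of_nat_sum)
  qed
  then show ?thesis
    by (simp add: finite_index_subgroups_above[OF H])
qed

end
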